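(* Let $k_1,k_2\ge 1$, let $A\in\mathbb{R}^{k_1\times k_2}$, and let $\eta_1,\eta_2>0$. (Agent 1.) If $x_1^t,x_1^{t+1}\in\mathbb{R}^{k_1}$ and $x_2^t\in\mathbb{R}^{k_2}$ satisfy agent 1's alternating gradient descent update $x_1^{t+1}=x_1^t+\eta_1Ax_2^t$, then $$\frac{\|x_1^{t+1}\|^2-\|x_1^t\|^2}{\eta_1}=\langle x_1^{t+1}+x_1^t,\,Ax_2^t\rangle .$$ (Agent 2.) Similarly, if $x_2^t,x_2^{t+1}\in\mathbb{R}^{k_2}$ and $x_1^{t+1}\in\mathbb{R}^{k_1}$ satisfy agent 2's alternating gradient descent update $x_2^{t+1}=x_2^t-\eta_2A^\intercal x_1^{t+1}$, then $$\frac{\|x_2^{t+1}\|^2-\|x_2^t\|^2}{\eta_2}=-\langle x_1^{t+1},\,A(x_2^{t+1}+x_2^t)\rangle .$$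
   Context: $\|\cdot\|$ and $\langle\cdot,\cdot\rangle$ are the Euclidean norm and inner product. In the underlying zero-sum game, agent 1 receives utility $\langle x_1,Ax_2\rangle$ and agent 2 receives $-\langle x_1,Ax_2\rangle$. *)

theory Defs
  imports "HOL-Analysis.Analysis"
begin

end

theory Submission
  imports Defs
begin

text \<open>In a real inner product space |y|^2 - |x|^2 = <y + x, y - x>, since the cross terms
  cancel by symmetry. A gradient step makes y - x the step size times a direction \<open>v\<close>,
  so dividing by the step size leaves <y + x, v>; this is
  \<open>norm_square_difference_quotient\<close>. Agent 1 moves along A x2; agent 2 moves along
  minus the transpose of A applied to x1', and adjointness then returns A to the other
  argument.\<close>

lemma norm_square_difference_quotient:
  fixes x v :: "'a :: real_inner"
  assumes "c \<noteq> 0" and "y = x + c *\<^sub>R v"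
  shows "((norm y)\<^sup>2 - (norm x)\<^sup>2) / c = (y + x) \<bullet> v"
proof -
  have "(norm y)\<^sup>2 - (norm x)\<^sup>2 = (y + x) \<bullet> (y - x)"
    by (simp add: power2_norm_eq_inner inner_add_left inner_diff_right inner_commute[of x y])
  also have "\<dots> = c * ((y + x) \<bullet> v)"
    using assms(2) by simp
  finally show ?thesis
    using assms(1) by simp
qed

theorem lemma1:
  fixes A :: "real ^ 'k2 ^ 'k1"
    and \<eta>1 \<eta>2 :: real
  assumes "\<eta>1 > 0" and "\<eta>2 > 0"
  shows "(\<forall>(x1 :: real ^ 'k1) (x1' :: real ^ 'k1) (x2 :: real ^ 'k2).
            x1' = x1 + \<eta>1 *\<^sub>R (A *v x2) \<longrightarrow>
            ((norm x1')\<^sup>2 - (norm x1)\<^sup>2) / \<eta>1 = (x1' + x1) \<bullet> (A *v x2))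
       \<and> (\<forall>(x2 :: real ^ 'k2) (x2' :: real ^ 'k2) (x1' :: real ^ 'k1).
            x2' = x2 - \<eta>2 *\<^sub>R (transpose A *v x1') \<longrightarrow>
            ((norm x2')\<^sup>2 - (norm x2)\<^sup>2) / \<eta>2 = - (x1' \<bullet> (A *v (x2' + x2))))"
proof (intro conjI allI impI)
  fix x1 x1' :: "real ^ 'k1" and x2 :: "real ^ 'k2"
  assume "x1' = x1 + \<eta>1 *\<^sub>R (A *v x2)"
  then show "((norm x1')\<^sup>2 - (norm x1)\<^sup>2) / \<eta>1 = (x1' + x1) \<bullet> (A *v x2)"
    using assms(1) by (intro norm_square_difference_quotient) auto
next
  fix x2 x2' :: "real ^ 'k2" and x1' :: "real ^ 'k1"
  assume "x2' = x2 - \<eta>2 *\<^sub>R (transpose A *v x1')"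
  \<comment> \<open>Agent 2 descends: the minus sign of the update is absorbed into the direction,
    so the step size stays \<open>\<eta>2\<close>.\<close>
  then have "((norm x2')\<^sup>2 - (norm x2)\<^sup>2) / \<eta>2 = (x2' + x2) \<bullet> (- (transpose A *v x1'))"
    using assms(2) by (intro norm_square_difference_quotient) auto
  \<comment> \<open>Writing the transposed product as the row-vector product \<open>x1' v* A\<close>
    puts the term in the shape of the adjoint identity \<open>dot_lmul_matrix\<close>.\<close>
  also have "\<dots> = - ((x1' v* A) \<bullet> (x2' + x2))"
    by (simp only: transpose_matrix_vector inner_minus_right inner_commute)
  finally show "((norm x2')\<^sup>2 - (norm x2)\<^sup>2) / \<eta>2 = - (x1' \<bullet> (A *v (x2' + x2)))"
    by (simp only: dot_lmul_matrix)
qed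

end
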